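(* $M(t)\ge N(t)$ for all real $t\ge 0$.
   Context: For real $t\ge 0$, $M(t)$ denotes the expected number of selections when numbers are selected independently and uniformly at random from $[0,1]$ until their sum is greater than $t$. That is, $M(t)$ is the expected value of $\min\{n\ge 1: X_1+\cdots+X_n>t\}$, where $X_1,X_2,\ldots$ are i.i.d. uniform on $[0,1]$. For real $t\ge 0$, $N(t)$ denotes the expected number of selections when numbers are selected independently and uniformly at random from $[1,e]$ until their product is greater than $e^t$. That is, $N(t)$ is the expected value of $\min\{n\ge 1: Z_1Z_2\cdots Z_n>e^t\}$, where $Z_1,Z_2,\ldots$ are i.i.d. uniform on $[1,e]$. *)

theory Defs
  imports "HOL-Probability.Probability"
begin

definition iid_uniform :: "'a measure \<Rightarrow> (nat \<Rightarrow> 'a \<Rightarrow> real) \<Rightarrow> real set \<Rightarrow> bool" where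
  "iid_uniform P X A \<longleftrightarrow>
     prob_space P \<and>
     prob_space.indep_vars P (\<lambda>_. borel) X {1..} \<and>
     (\<forall>i\<ge>1. distr P borel (X i) = uniform_measure lborel A)"

text \<open>The minimum is infinite if the event never occurs; for the sequences considered below
  this happens only on a null set.\<close>

definition first_index :: "(nat \<Rightarrow> bool) \<Rightarrow> ennreal" where
  "first_index Q =
     (if \<exists>n\<ge>1. Q n then of_nat (LEAST n. 1 \<le> n \<and> Q n) else \<infinity>)"

text \<open>\<open>M P X t\<close> and \<open>N Q Z t\<close> are expected values of nonnegative functions, taken in
  \<^typ>\<open>ennreal\<close>, so that no integrability convention intervenes. They stand for $M(t)$ and
  $N(t)$ when \<open>X\<close> and \<open>Z\<close> are i.i.d. uniform on $[0,1]$ and $[1,e]$ respectively; they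
  then depend only on \<open>t\<close>, not on the underlying probability space.\<close>

definition M :: "'a measure \<Rightarrow> (nat \<Rightarrow> 'a \<Rightarrow> real) \<Rightarrow> real \<Rightarrow> ennreal" where
  "M P X t = (\<integral>\<^sup>+ \<omega>. first_index (\<lambda>n. (\<Sum>i=1..n. X i \<omega>) > t) \<partial>P)"

definition N :: "'b measure \<Rightarrow> (nat \<Rightarrow> 'b \<Rightarrow> real) \<Rightarrow> real \<Rightarrow> ennreal" where
  "N Q Z t = (\<integral>\<^sup>+ \<omega>. first_index (\<lambda>n. (\<Prod>i=1..n. Z i \<omega>) > exp t) \<partial>Q)"

end

theory Submission
  imports Defs
begin

text \<open>
  The proof is a coupling. If \<open>X\<close> is uniform on \<open>[0,1]\<close>, then \<open>1 + (e - 1) X\<close> is uniform on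
  \<open>[1,e]\<close>, and convexity of the exponential function puts it above \<open>exp X\<close>: the chord of
  \<open>exp\<close> over \<open>[0,1]\<close> lies above the graph. So an i.i.d. sequence that is uniform on \<open>[0,1]\<close>
  yields, on the same probability space, an i.i.d. sequence that is uniform on \<open>[1,e]\<close> and whose
  partial products are almost surely at least the exponentials of the partial sums. The product
  therefore passes \<open>exp t\<close> no later than the sum passes \<open>t\<close>, and integration compares the
  expectations.

  This yields the inequality for one particular uniform sequence on \<open>[1,e]\<close>. An arbitrary one,
  possibly on another probability space, has the same joint law, and \<open>N\<close> depends only on that
  law (\<open>N_cong_iid_uniform\<close>).
\<close>

lemma first_index_antimono:
  assumes "\<And>n. 1 \<le> n \<Longrightarrow> R n \<Longrightarrow> S n"
  shows "first_index S \<le> first_index R"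
proof (cases "\<exists>n\<ge>1. R n")
  case True
  then have "1 \<le> (LEAST n. 1 \<le> n \<and> R n) \<and> R (LEAST n. 1 \<le> n \<and> R n)"
    by (rule LeastI_ex)
  then have "1 \<le> (LEAST n. 1 \<le> n \<and> R n) \<and> S (LEAST n. 1 \<le> n \<and> R n)"
    using assms by blast
  then have "(LEAST n. 1 \<le> n \<and> S n) \<le> (LEAST n. 1 \<le> n \<and> R n)"
    by (rule Least_le)
  moreover have "\<exists>n\<ge>1. S n"
    using True assms by blast
  ultimately show ?thesis
    using True by (simp add: first_index_def)
qed (auto simp: first_index_def)

lemma measurable_first_index [measurable]:
  assumes [measurable]: "\<And>n. Measurable.pred L (\<lambda>x. R n x)"
  shows "(\<lambda>x. first_index (\<lambda>n. R n x)) \<in> borel_measurable L"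
  unfolding first_index_def by measurable

lemma distr_uniform_measure_affine:
  fixes a b :: real
  assumes "a < b"
  shows "distr (uniform_measure lborel {0..1}) borel (\<lambda>x. a + (b - a) * x)
       = uniform_measure lborel {a..b}"
proof (rule measure_eqI)
  fix B :: "real set"
  assume "B \<in> sets (distr (uniform_measure lborel {0..1}) borel (\<lambda>x. a + (b - a) * x))"
  then have [measurable]: "B \<in> sets borel"
    by simp
  define C where "C = {0..1} \<inter> (\<lambda>x. a + (b - a) * x) -` B"
  have vimage [measurable]: "(\<lambda>x. a + (b - a) * x) -` B \<in> sets borel"
    by (rule measurable_sets_borel[where M = borel]) measurable
  have [measurable]: "C \<in> sets borel"
    unfolding C_def by measurable
  have range: "a + (b - a) * x \<in> {a..b} \<longleftrightarrow> x \<in> {0..1}" for x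
  proof -
    have "a + (b - a) * x \<le> b \<longleftrightarrow> (b - a) * x \<le> (b - a) * 1"
      by (simp add: algebra_simps)
    also have "\<dots> \<longleftrightarrow> x \<le> 1"
      using assms by (subst mult_le_cancel_left_pos) auto
    finally show ?thesis
      using assms by (simp add: zero_le_mult_iff)
  qed
  have "emeasure lborel ({a..b} \<inter> B) = (\<integral>\<^sup>+x. indicator ({a..b} \<inter> B) x \<partial>lborel)"
    by simp
  also have "\<dots> = ennreal \<bar>b - a\<bar> * (\<integral>\<^sup>+x. indicator ({a..b} \<inter> B) (a + (b - a) * x) \<partial>lborel)"
    using assms by (intro nn_integral_real_affine) auto
  also have "(\<lambda>x. indicator ({a..b} \<inter> B) (a + (b - a) * x) :: ennreal) = indicator C"
    using range by (auto simp: C_def fun_eq_iff indicator_def)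
  finally have "emeasure lborel ({a..b} \<inter> B) = ennreal (b - a) * emeasure lborel C"
    using assms by simp
  then have "emeasure lborel ({a..b} \<inter> B) / ennreal (b - a) = emeasure lborel C"
    using assms by (simp add: ennreal_mult_divide_eq mult.commute[of "ennreal (b - a)"])
  moreover have "r / 1 = r" for r :: ennreal
    using ennreal_mult_divide_eq[of 1 r] by simp
  ultimately show "emeasure (distr (uniform_measure lborel {0..1}) borel (\<lambda>x. a + (b - a) * x)) B
      = emeasure (uniform_measure lborel {a..b}) B"
    using assms vimage by (simp add: emeasure_distr C_def)
qed simp

lemma iid_uniform_affine:
  assumes "iid_uniform P X {0..1}" and "a < b"
  shows "iid_uniform P (\<lambda>i \<omega>. a + (b - a) * X i \<omega>) {a..b}"
proof -
  interpret prob_space P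
    using assms(1) by (simp add: iid_uniform_def)
  have indep: "indep_vars (\<lambda>_. borel) X {1..}"
    and law: "\<And>i. 1 \<le> i \<Longrightarrow> distr P borel (X i) = uniform_measure lborel {0..1}"
    using assms(1) by (auto simp: iid_uniform_def)
  have "distr P borel (\<lambda>\<omega>. a + (b - a) * X i \<omega>) = uniform_measure lborel {a..b}"
    if "1 \<le> i" for i
  proof -
    have "random_variable borel (X i)"
      using indep that by (auto simp: indep_vars_def)
    then have "distr P borel (\<lambda>\<omega>. a + (b - a) * X i \<omega>)
        = distr (distr P borel (X i)) borel (\<lambda>x. a + (b - a) * x)"
      by (simp add: distr_distr o_def)
    then show ?thesis
      using law[OF that] distr_uniform_measure_affine[OF assms(2)] by simp
  qed
  moreover have "indep_vars (\<lambda>_. borel) (\<lambda>i \<omega>. a + (b - a) * X i \<omega>) {1..}"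
    by (rule indep_vars_compose2[OF indep, where Y = "\<lambda>_ x. a + (b - a) * x"]) measurable
  ultimately show ?thesis
    by (simp add: iid_uniform_def prob_space_axioms)
qed

lemma distr_PiM_iid_uniform:
  assumes "iid_uniform P X A"
  shows "(\<lambda>\<omega>. \<lambda>i\<in>{1..}. X i \<omega>) \<in> measurable P (PiM {1..} (\<lambda>_. borel))"
    and "distr P (PiM {1..} (\<lambda>_. borel)) (\<lambda>\<omega>. \<lambda>i\<in>{1..}. X i \<omega>)
       = PiM {1..} (\<lambda>_. uniform_measure lborel A)"
proof -
  interpret prob_space P
    using assms by (simp add: iid_uniform_def)
  have indep: "indep_vars (\<lambda>_. borel) X {1..}"
    using assms by (simp add: iid_uniform_def)
  then have rv: "random_variable borel (X i)" if "i \<in> {1..}" for i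
    using that by (auto simp: indep_vars_def)
  then show "(\<lambda>\<omega>. \<lambda>i\<in>{1..}. X i \<omega>) \<in> measurable P (PiM {1..} (\<lambda>_. borel))"
    by (rule measurable_restrict)
  have "distr P (PiM {1..} (\<lambda>_. borel)) (\<lambda>\<omega>. \<lambda>i\<in>{1..}. X i \<omega>)
      = PiM {1..} (\<lambda>i. distr P borel (X i))"
    using indep rv by (subst (asm) indep_vars_iff_distr_eq_PiM') auto
  also have "\<dots> = PiM {1..} (\<lambda>_. uniform_measure lborel A)"
    using assms by (intro PiM_cong) (auto simp: iid_uniform_def)
  finally show "distr P (PiM {1..} (\<lambda>_. borel)) (\<lambda>\<omega>. \<lambda>i\<in>{1..}. X i \<omega>)
      = PiM {1..} (\<lambda>_. uniform_measure lborel A)" .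
qed

text \<open>The waiting time is a measurable functional of the path \<open>(Z\<^sub>1, Z\<^sub>2, \<dots>)\<close>, so its
  expectation is an integral against the joint law, here a power of the uniform measure.\<close>

lemma N_eq_nn_integral_PiM:
  assumes "iid_uniform Q Z A"
  shows "N Q Z t = (\<integral>\<^sup>+ z. first_index (\<lambda>n. (\<Prod>i=1..n. z i) > exp t)
                      \<partial>PiM {1..} (\<lambda>_. uniform_measure lborel A))"
proof -
  have [measurable]: "(\<lambda>z. \<Prod>i=1..n. z i) \<in> borel_measurable (PiM {1::nat..} (\<lambda>_. borel::real measure))"
    for n
    by (intro borel_measurable_prod measurable_component_singleton) auto
  have "(\<integral>\<^sup>+ z. first_index (\<lambda>n. (\<Prod>i=1..n. z i) > exp t)
           \<partial>PiM {1..} (\<lambda>_. uniform_measure lborel A))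
      = (\<integral>\<^sup>+ \<omega>. first_index (\<lambda>n. (\<Prod>i=1..n. (\<lambda>i\<in>{1..}. Z i \<omega>) i) > exp t) \<partial>Q)"
    unfolding distr_PiM_iid_uniform(2)[OF assms, symmetric]
    by (intro nn_integral_distr distr_PiM_iid_uniform(1)[OF assms]) measurable
  then show ?thesis
    by (simp add: N_def)
qed

lemma N_cong_iid_uniform:
  assumes "iid_uniform P Y A" and "iid_uniform Q Z A"
  shows "N P Y t = N Q Z t"
  by (simp add: N_eq_nn_integral_PiM[OF assms(1)] N_eq_nn_integral_PiM[OF assms(2)])

lemma AE_iid_uniform_mem:
  fixes X :: "nat \<Rightarrow> 'a \<Rightarrow> real"
  assumes "iid_uniform P X A" and "A \<in> sets borel"
  shows "AE \<omega> in P. \<forall>i\<ge>1. X i \<omega> \<in> A"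
proof -
  interpret prob_space P
    using assms(1) by (simp add: iid_uniform_def)
  have "AE \<omega> in P. X i \<omega> \<in> A" if "1 \<le> i" for i
  proof -
    have "random_variable borel (X i)"
      using assms(1) that by (auto simp: iid_uniform_def indep_vars_def)
    moreover have "AE x in distr P borel (X i). x \<in> A"
    proof -
      have "AE x in uniform_measure lborel A. x \<in> A"
        using assms(2) by (intro AE_uniform_measureI) auto
      moreover have "distr P borel (X i) = uniform_measure lborel A"
        using assms(1) that by (simp add: iid_uniform_def)
      ultimately show ?thesis
        by metis
    qed
    ultimately show ?thesis
      using assms(2) by (simp add: AE_distr_iff)
  qed
  then show ?thesis
    by (simp add: AE_all_countable)
qed

lemma exp_le_chord:
  fixes x :: real
  assumes "x \<in> {0..1}"
  shows "exp x \<le> 1 + (exp 1 - 1) * x"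
  using convex_onD[OF exp_convex, of x 0 1] assms by (simp add: algebra_simps)

theorem theorem9:
  fixes P :: "'a measure" and X :: "nat \<Rightarrow> 'a \<Rightarrow> real"
    and Q :: "'b measure" and Z :: "nat \<Rightarrow> 'b \<Rightarrow> real"
    and t :: real
  assumes "iid_uniform P X {0..1}"
    and "iid_uniform Q Z {1..exp 1}"
    and "t \<ge> 0"
  shows "M P X t \<ge> N Q Z t"
proof -
  define Y where "Y i \<omega> = 1 + (exp 1 - 1) * X i \<omega>" for i \<omega>
  have "iid_uniform P Y {1..exp 1}"
    using iid_uniform_affine[OF assms(1), of 1 "exp 1"] by (simp add: Y_def[abs_def])
  then have "N Q Z t = N P Y t"
    using assms(2) by (intro N_cong_iid_uniform)
  also have "\<dots> \<le> M P X t"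
    unfolding N_def M_def
  proof (rule nn_integral_mono_AE)
    have "AE \<omega> in P. \<forall>i\<ge>1. X i \<omega> \<in> {0..1}"
      by (rule AE_iid_uniform_mem[OF assms(1)]) simp
    then show "AE \<omega> in P. first_index (\<lambda>n. (\<Prod>i=1..n. Y i \<omega>) > exp t)
        \<le> first_index (\<lambda>n. (\<Sum>i=1..n. X i \<omega>) > t)"
    proof eventually_elim
      case (elim \<omega>)
      show ?case
      proof (rule first_index_antimono)
        fix n :: nat
        assume "(\<Sum>i=1..n. X i \<omega>) > t"
        then have "exp t < exp (\<Sum>i=1..n. X i \<omega>)"
          by simp
        also have "\<dots> = (\<Prod>i=1..n. exp (X i \<omega>))"
          by (simp add: exp_sum)
        also have "\<dots> \<le> (\<Prod>i=1..n. Y i \<omega>)"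
          using elim exp_le_chord by (intro prod_mono) (auto simp: Y_def)
        finally show "(\<Prod>i=1..n. Y i \<omega>) > exp t" .
      qed
    qed
  qed
  finally show ?thesis .
qed

end
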